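(* Let $S$ be a Boolean inverse $\wedge$-monoid. Then its associated Boolean groupoid $\mathsf{G}(S)$ is effective if and only if $S$ is fundamental.
   Context: An inverse semigroup is a semigroup $S$ in which each $s$ has a unique $s^{-1}$ with $s=ss^{-1}s$, $s^{-1}=s^{-1}ss^{-1}$. All inverse monoids have a zero $0$. $E(S)$ is the set of idempotents (they commute), ordered by $e\le f\iff e=ef$. The natural partial order is $s\le t\iff s=ts^{-1}s$; meets $\wedge$ and joins $\vee$ are taken with respect to it. $a,b$ are compatible if $ab^{-1}$ and $a^{-1}b$ are idempotents. $S$ is distributive if every compatible pair has a join and multiplication distributes over all binary joins that exist. A Boolean inverse monoid is a distributive inverse monoid whose idempotents form a Boolean algebra; it is a Boolean inverse $\wedge$-monoid if in addition every pair of elements has a meet. $S$ is fundamental if every element commuting with all idempotents is an idempotent. $\mathsf{G}(S)$ is the set of ultrafilters of $S$ (maximal among nonempty subsets not containing $0$ that are closed under finite meets and upward closed), a groupoid with $\mathbf{d}(A)=(A^{-1}A)^{\uparrow}$, $\mathbf{r}(A)=(AA^{-1})^{\uparrow}$ (upward closures) and product $A\cdot B=(AB)^{\uparrow}$ when $\mathbf{d}(A)=\mathbf{r}(B)$, topologized by the basis $V_a=\{A: a\in A\}$, $a\in S$. An étale groupoid $G$ with set of identities $G_o$ is effective if the interior of $\mathrm{Iso}(G)=\{g\in G: g^{-1}g=gg^{-1}\}$ equals $G_o$. *)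

theory Defs
  imports "HOL-Analysis.Abstract_Topology" "HOL-Algebra.Lattice" "HOL-Algebra.Coset"
begin

section \<open>Inverse monoids with zero\<close>

definition inverse_of :: "('a, 'b) monoid_scheme \<Rightarrow> 'a \<Rightarrow> 'a \<Rightarrow> bool" where
  "inverse_of S s t \<longleftrightarrow>
     t \<in> carrier S \<and> s = s \<otimes>\<^bsub>S\<^esub> t \<otimes>\<^bsub>S\<^esub> s \<and> t = t \<otimes>\<^bsub>S\<^esub> s \<otimes>\<^bsub>S\<^esub> t"

definition is_zero :: "('a, 'b) monoid_scheme \<Rightarrow> 'a \<Rightarrow> bool" where
  "is_zero S z \<longleftrightarrow>
     z \<in> carrier S \<and> (\<forall>s\<in>carrier S. z \<otimes>\<^bsub>S\<^esub> s = z \<and> s \<otimes>\<^bsub>S\<^esub> z = z)"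

locale inverse_monoid = monoid S for S (structure) +
  assumes inverse_ex1: "s \<in> carrier S \<Longrightarrow> \<exists>!t. inverse_of S s t"
    and zero_ex: "\<exists>z. is_zero S z"

text \<open>The inverse-semigroup inverse must not be confused with \<^const>\<open>m_inv\<close>,
  which is the inverse of a unit.\<close>

definition sinv :: "('a, 'b) monoid_scheme \<Rightarrow> 'a \<Rightarrow> 'a" where
  "sinv S s = (THE t. inverse_of S s t)"

definition idems :: "('a, 'b) monoid_scheme \<Rightarrow> 'a set" where
  "idems S = {e \<in> carrier S. e \<otimes>\<^bsub>S\<^esub> e = e}"

definition idem_order :: "('a, 'b) monoid_scheme \<Rightarrow> 'a gorder" where
  "idem_order S = \<lparr>carrier = idems S, eq = (=), le = (\<lambda>e f. e = e \<otimes>\<^bsub>S\<^esub> f)\<rparr>"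

definition nat_order :: "('a, 'b) monoid_scheme \<Rightarrow> 'a gorder" where
  "nat_order S =
     \<lparr>carrier = carrier S, eq = (=), le = (\<lambda>s t. s = t \<otimes>\<^bsub>S\<^esub> sinv S s \<otimes>\<^bsub>S\<^esub> s)\<rparr>"

definition is_join :: "('a, 'b) monoid_scheme \<Rightarrow> 'a \<Rightarrow> 'a \<Rightarrow> 'a \<Rightarrow> bool" where
  "is_join S j a b \<longleftrightarrow> least (nat_order S) j (Upper (nat_order S) {a, b})"

definition is_meet :: "('a, 'b) monoid_scheme \<Rightarrow> 'a \<Rightarrow> 'a \<Rightarrow> 'a \<Rightarrow> bool" where
  "is_meet S m a b \<longleftrightarrow> greatest (nat_order S) m (Lower (nat_order S) {a, b})"

definition compatible :: "('a, 'b) monoid_scheme \<Rightarrow> 'a \<Rightarrow> 'a \<Rightarrow> bool" where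
  "compatible S a b \<longleftrightarrow> a \<otimes>\<^bsub>S\<^esub> sinv S b \<in> idems S \<and> sinv S a \<otimes>\<^bsub>S\<^esub> b \<in> idems S"

text \<open>Joins are treated relationally because they need not exist; distributivity over
  \<open>a \<or> b\<close> asserts in particular that the join of the products exists.\<close>

locale distributive_inverse_monoid = inverse_monoid +
  assumes compatible_join:
      "\<lbrakk>a \<in> carrier S; b \<in> carrier S; compatible S a b\<rbrakk> \<Longrightarrow> \<exists>j. is_join S j a b"
    and mult_join_left:
      "\<lbrakk>a \<in> carrier S; b \<in> carrier S; c \<in> carrier S; is_join S j a b\<rbrakk>
         \<Longrightarrow> is_join S (c \<otimes> j) (c \<otimes> a) (c \<otimes> b)"
    and mult_join_right:
      "\<lbrakk>a \<in> carrier S; b \<in> carrier S; c \<in> carrier S; is_join S j a b\<rbrakk>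
         \<Longrightarrow> is_join S (j \<otimes> c) (a \<otimes> c) (b \<otimes> c)"

text \<open>A Boolean algebra, as an order: a bounded distributive complemented lattice.
  The one-element Boolean algebra is allowed.\<close>

locale boolean_lattice = bounded_lattice L for L (structure) +
  assumes meet_join_distrib:
      "\<lbrakk>x \<in> carrier L; y \<in> carrier L; z \<in> carrier L\<rbrakk>
         \<Longrightarrow> x \<sqinter> (y \<squnion> z) = (x \<sqinter> y) \<squnion> (x \<sqinter> z)"
    and complement_ex:
      "x \<in> carrier L \<Longrightarrow> \<exists>y\<in>carrier L. x \<sqinter> y = \<bottom> \<and> x \<squnion> y = \<top>"

locale boolean_inverse_monoid = distributive_inverse_monoid +
  assumes idems_boolean: "boolean_lattice (idem_order S)"

locale boolean_inverse_meet_monoid = boolean_inverse_monoid +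
  assumes meet_ex: "\<lbrakk>a \<in> carrier S; b \<in> carrier S\<rbrakk> \<Longrightarrow> \<exists>m. is_meet S m a b"

definition fundamental :: "('a, 'b) monoid_scheme \<Rightarrow> bool" where
  "fundamental S \<longleftrightarrow>
     (\<forall>s\<in>carrier S. (\<forall>e\<in>idems S. s \<otimes>\<^bsub>S\<^esub> e = e \<otimes>\<^bsub>S\<^esub> s) \<longrightarrow> s \<in> idems S)"


section \<open>Topological groupoids and effectiveness\<close>

text \<open>\<open>gprod G g h\<close> is meaningful only when \<open>gdom G g = gcod G h\<close>.\<close>

record 'g top_groupoid = "'g partial_object" +
  gdom :: "'g \<Rightarrow> 'g"
  gcod :: "'g \<Rightarrow> 'g"
  gprod :: "'g \<Rightarrow> 'g \<Rightarrow> 'g"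
  ginv :: "'g \<Rightarrow> 'g"
  gtop :: "'g topology"

definition identities :: "('g, 'c) top_groupoid_scheme \<Rightarrow> 'g set" where
  "identities G = gdom G ` carrier G"

definition Iso :: "('g, 'c) top_groupoid_scheme \<Rightarrow> 'g set" where
  "Iso G = {g \<in> carrier G. gprod G (ginv G g) g = gprod G g (ginv G g)}"

definition effective :: "('g, 'c) top_groupoid_scheme \<Rightarrow> bool" where
  "effective G \<longleftrightarrow> (gtop G) interior_of (Iso G) = identities G"


section \<open>The groupoid of ultrafilters\<close>

definition up_closure :: "('a, 'b) monoid_scheme \<Rightarrow> 'a set \<Rightarrow> 'a set" where
  "up_closure S A = {t \<in> carrier S. \<exists>a\<in>A. a \<sqsubseteq>\<^bsub>nat_order S\<^esub> t}"

definition proper_filter :: "('a, 'b) monoid_scheme \<Rightarrow> 'a set \<Rightarrow> bool" where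
  "proper_filter S A \<longleftrightarrow>
     A \<subseteq> carrier S \<and> A \<noteq> {} \<and>
     (\<forall>z. is_zero S z \<longrightarrow> z \<notin> A) \<and>
     (\<forall>a\<in>A. \<forall>b\<in>A. \<exists>m\<in>A. is_meet S m a b) \<and>
     (\<forall>a\<in>A. \<forall>t\<in>carrier S. a \<sqsubseteq>\<^bsub>nat_order S\<^esub> t \<longrightarrow> t \<in> A)"

definition ultrafilter :: "('a, 'b) monoid_scheme \<Rightarrow> 'a set \<Rightarrow> bool" where
  "ultrafilter S A \<longleftrightarrow>
     proper_filter S A \<and> (\<forall>B. proper_filter S B \<and> A \<subseteq> B \<longrightarrow> B = A)"

definition ultrafilters_at :: "('a, 'b) monoid_scheme \<Rightarrow> 'a \<Rightarrow> 'a set set" where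
  "ultrafilters_at S a = {A. ultrafilter S A \<and> a \<in> A}"

text \<open>The sets \<open>ultrafilters_at S a\<close> are closed under binary intersection (through meets in
  \<open>S\<close>) and cover, so the topology they generate has them as a basis, not only as a subbasis.\<close>

definition ultrafilter_groupoid :: "('a, 'b) monoid_scheme \<Rightarrow> 'a set top_groupoid" where
  "ultrafilter_groupoid S =
     \<lparr>carrier = {A. ultrafilter S A},
      gdom = (\<lambda>A. up_closure S (sinv S ` A <#>\<^bsub>S\<^esub> A)),
      gcod = (\<lambda>A. up_closure S (A <#>\<^bsub>S\<^esub> sinv S ` A)),
      gprod = (\<lambda>A B. up_closure S (A <#>\<^bsub>S\<^esub> B)),
      ginv = (\<lambda>A. sinv S ` A),
      gtop = topology_generated_by (ultrafilters_at S ` carrier S)\<rparr>"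

end

theory Submission
  imports Defs
begin

text \<open>
  Call \<open>s\<^sup>\<star> s\<close> the domain and \<open>s s\<^sup>\<star>\<close> the range of an element \<open>s\<close>, where \<open>s\<^sup>\<star>\<close> is its inverse.
  For an ultrafilter \<open>A\<close> the products defining \<open>d(A)\<close> and \<open>r(A)\<close> may be restricted to
  the diagonal: \<open>d(A)\<close> is generated by the domains of the elements of \<open>A\<close> and \<open>r(A)\<close> by
  their ranges.  An ultrafilter lies in \<open>Iso\<close> when these two filters coincide, and
  it is an identity exactly when it contains an idempotent (\<open>identities_iff_idem\<close>).  Because
  the sets \<open>V\<^sub>a\<close> form a basis, the theorem is a comparison of two conditions on single
  elements \<open>a\<close>.

  The first is that \<open>V\<^sub>a \<subseteq> Iso\<close>; it holds exactly when \<open>a\<close> commutes with every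
  idempotent (\<open>basic_subset_Iso_iff_commute\<close>).  If \<open>a\<close> commutes with the idempotents, then so
  does every \<open>c \<le> a\<close>, which forces \<open>c\<^sup>\<star> c = c c\<^sup>\<star>\<close>; such \<open>c\<close> are cofinal downwards in any
  ultrafilter through \<open>a\<close>.  If \<open>a e \<noteq> e a\<close> for some idempotent \<open>e\<close> with complement \<open>e'\<close>, then
  one of the elements \<open>e' a e\<close> and \<open>e a e'\<close> is nonzero.  It lies below \<open>a\<close> and moves its
  domain off itself, so an ultrafilter through it is in \<open>V\<^sub>a\<close> but has \<open>d(A) \<noteq> r(A)\<close>
  (\<open>noncommuting_orthogonal\<close>, \<open>filter_dom_cod_not_orthogonal\<close>).

  The second is that \<open>V\<^sub>a\<close> consists of identities; it holds exactly when \<open>a\<close> is an idempotent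
  (\<open>idem_if_ultrafilters_contain_idem\<close>).  Here binary meets matter: \<open>a \<and> 1\<close> is the largest
  idempotent below \<open>a\<close>, and if it were smaller than \<open>a\<close>, the part of \<open>a\<close> off it would be
  nonzero, and an ultrafilter through that part could not contain an idempotent.

  So the interior of \<open>Iso\<close> is the union of the \<open>V\<^sub>a\<close> with \<open>a\<close> commuting with all idempotents, and the
  space of identities is the union of the \<open>V\<^sub>a\<close> with \<open>a\<close> idempotent.  These agree if the two
  classes of elements agree, which is fundamentality; conversely, if they agree then every
  ultrafilter through an element commuting with the idempotents contains an idempotent,
  so the element is itself idempotent.
\<close>

section \<open>Inverses, idempotents and the natural partial order\<close>

context inverse_monoid
begin

abbreviation star :: "'a \<Rightarrow> 'a" ("_\<^sup>\<star>" [1000] 999)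
  where "s\<^sup>\<star> \<equiv> sinv S s"

abbreviation nle :: "'a \<Rightarrow> 'a \<Rightarrow> bool" (infix "\<preceq>" 50)
  where "s \<preceq> t \<equiv> s \<sqsubseteq>\<^bsub>nat_order S\<^esub> t"

lemma nle_iff: "s \<preceq> t \<longleftrightarrow> s = t \<otimes> s\<^sup>\<star> \<otimes> s"
  by (simp add: nat_order_def)

lemma idemsD [dest]: "e \<in> idems S \<Longrightarrow> e \<in> carrier S" "e \<in> idems S \<Longrightarrow> e \<otimes> e = e"
  by (simp_all add: idems_def)

lemma idemsI: "e \<in> carrier S \<Longrightarrow> e \<otimes> e = e \<Longrightarrow> e \<in> idems S"
  by (simp add: idems_def)

lemma idem_absorb: "e \<in> idems S \<Longrightarrow> x \<in> carrier S \<Longrightarrow> e \<otimes> (e \<otimes> x) = e \<otimes> x"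
  by (metis idemsD m_assoc)

lemma sinv_inverse: "s \<in> carrier S \<Longrightarrow> inverse_of S s (s\<^sup>\<star>)"
  unfolding sinv_def using inverse_ex1 by (rule theI')

lemma sinv_closed [simp, intro]: "s \<in> carrier S \<Longrightarrow> s\<^sup>\<star> \<in> carrier S"
  using sinv_inverse by (simp add: inverse_of_def)

lemma sinv_unique: "s \<in> carrier S \<Longrightarrow> inverse_of S s t \<Longrightarrow> s\<^sup>\<star> = t"
  using inverse_ex1 sinv_inverse by blast

lemma mult_sinv_mult [simp]:
  assumes "s \<in> carrier S"
  shows "s \<otimes> (s\<^sup>\<star> \<otimes> s) = s" "s\<^sup>\<star> \<otimes> (s \<otimes> s\<^sup>\<star>) = s\<^sup>\<star>"
  using sinv_inverse[OF assms] assms by (auto simp: inverse_of_def m_assoc)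

lemma mult_sinv_mult_assoc [simp]:
  assumes "s \<in> carrier S" "x \<in> carrier S"
  shows "s \<otimes> (s\<^sup>\<star> \<otimes> (s \<otimes> x)) = s \<otimes> x" "s\<^sup>\<star> \<otimes> (s \<otimes> (s\<^sup>\<star> \<otimes> x)) = s\<^sup>\<star> \<otimes> x"
  using mult_sinv_mult[OF assms(1)] assms by (metis m_assoc m_closed sinv_closed)+

lemma sinv_sinv [simp]: "s \<in> carrier S \<Longrightarrow> (s\<^sup>\<star>)\<^sup>\<star> = s"
  by (rule sinv_unique) (auto simp: inverse_of_def m_assoc)

lemma sinv_idem: "e \<in> idems S \<Longrightarrow> e\<^sup>\<star> = e"
  by (rule sinv_unique) (auto simp: inverse_of_def)

lemma mult_idems_idem:
  assumes e: "e \<in> idems S" and f: "f \<in> idems S"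
  shows "e \<otimes> f \<in> idems S"
proof -
  have [simp]: "e \<in> carrier S" "f \<in> carrier S" "e \<otimes> e = e" "f \<otimes> f = f" using e f by auto
  note [simp] = idem_absorb[OF e] idem_absorb[OF f]
  define x where "x = (e \<otimes> f)\<^sup>\<star>"
  have [simp]: "x \<in> carrier S" by (simp add: x_def)
  have x1: "e \<otimes> (f \<otimes> (x \<otimes> (e \<otimes> f))) = e \<otimes> f"
    using mult_sinv_mult(1)[of "e \<otimes> f"] by (simp add: x_def m_assoc del: mult_sinv_mult)
  have x2: "x \<otimes> (e \<otimes> (f \<otimes> x)) = x"
    using mult_sinv_mult(2)[of "e \<otimes> f"] by (simp add: x_def m_assoc del: mult_sinv_mult)
  have x2': "x \<otimes> (e \<otimes> (f \<otimes> (x \<otimes> y))) = x \<otimes> y" if "y \<in> carrier S" for y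
    using arg_cong[OF x2, of "\<lambda>z. z \<otimes> y"] that by (simp add: m_assoc)
  \<comment> \<open>Uniqueness of the inverse turns \<open>x\<close> into \<open>f \<otimes> x \<otimes> e\<close>, a form that is visibly idempotent.\<close>
  have "(e \<otimes> f)\<^sup>\<star> = f \<otimes> x \<otimes> e"
    by (rule sinv_unique) (simp_all add: inverse_of_def m_assoc x1 x2')
  then have x: "x = f \<otimes> x \<otimes> e" by (simp add: x_def)
  have "x \<otimes> x = (f \<otimes> x \<otimes> e) \<otimes> (f \<otimes> x \<otimes> e)" using x by simp
  also have "\<dots> = f \<otimes> x \<otimes> e" by (simp add: m_assoc x2')
  finally have "x \<in> idems S" using x by (simp add: idemsI)
  then have "x = e \<otimes> f"
    using sinv_idem[of x] sinv_sinv[of "e \<otimes> f"] by (simp add: x_def)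
  with \<open>x \<in> idems S\<close> show ?thesis by simp
qed

text \<open>Since \<open>e f\<close> and \<open>f e\<close> are idempotent, \<open>f e\<close> is an inverse of \<open>e f\<close>; so is \<open>e f\<close> itself,
  and inverses are unique.\<close>

lemma idems_commute:
  assumes e: "e \<in> idems S" and f: "f \<in> idems S"
  shows "e \<otimes> f = f \<otimes> e"
proof -
  have [simp]: "e \<in> carrier S" "f \<in> carrier S" using e f by auto
  note [simp] = idem_absorb[OF e] idem_absorb[OF f]
  have "e \<otimes> (f \<otimes> (e \<otimes> f)) = e \<otimes> f" "f \<otimes> (e \<otimes> (f \<otimes> e)) = f \<otimes> e"
    using mult_idems_idem[OF e f] mult_idems_idem[OF f e] by (auto simp: idems_def m_assoc)
  then have "(e \<otimes> f)\<^sup>\<star> = f \<otimes> e"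
    by (intro sinv_unique) (simp_all add: inverse_of_def m_assoc)
  then show ?thesis using sinv_idem[OF mult_idems_idem[OF e f]] by simp
qed

lemma idems_left_commute:
  assumes "e \<in> idems S" "f \<in> idems S" "x \<in> carrier S"
  shows "e \<otimes> (f \<otimes> x) = f \<otimes> (e \<otimes> x)"
  using assms idems_commute[of e f] by (metis idemsD(1) m_assoc)

lemma domain_idem [simp, intro]: "s \<in> carrier S \<Longrightarrow> s\<^sup>\<star> \<otimes> s \<in> idems S"
  and range_idem [simp, intro]: "s \<in> carrier S \<Longrightarrow> s \<otimes> s\<^sup>\<star> \<in> idems S"
  by (auto intro!: idemsI simp: m_assoc)

lemma one_idem [simp, intro]: "\<one> \<in> idems S"
  by (auto intro: idemsI)

lemma sinv_mult:
  assumes [simp]: "s \<in> carrier S" "t \<in> carrier S"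
  shows "(s \<otimes> t)\<^sup>\<star> = t\<^sup>\<star> \<otimes> s\<^sup>\<star>"
proof (rule sinv_unique)
  have c: "(t \<otimes> t\<^sup>\<star>) \<otimes> (s\<^sup>\<star> \<otimes> s) = (s\<^sup>\<star> \<otimes> s) \<otimes> (t \<otimes> t\<^sup>\<star>)"
    by (rule idems_commute) auto
  have "s \<otimes> t \<otimes> (t\<^sup>\<star> \<otimes> s\<^sup>\<star>) \<otimes> (s \<otimes> t) = s \<otimes> ((t \<otimes> t\<^sup>\<star>) \<otimes> (s\<^sup>\<star> \<otimes> s)) \<otimes> t"
    by (simp add: m_assoc)
  also have "\<dots> = s \<otimes> t" unfolding c by (simp add: m_assoc)
  finally have 1: "s \<otimes> t \<otimes> (t\<^sup>\<star> \<otimes> s\<^sup>\<star>) \<otimes> (s \<otimes> t) = s \<otimes> t" .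
  have "t\<^sup>\<star> \<otimes> s\<^sup>\<star> \<otimes> (s \<otimes> t) \<otimes> (t\<^sup>\<star> \<otimes> s\<^sup>\<star>) = t\<^sup>\<star> \<otimes> ((s\<^sup>\<star> \<otimes> s) \<otimes> (t \<otimes> t\<^sup>\<star>)) \<otimes> s\<^sup>\<star>"
    by (simp add: m_assoc)
  also have "\<dots> = t\<^sup>\<star> \<otimes> s\<^sup>\<star>" unfolding c[symmetric] by (simp add: m_assoc)
  finally show "inverse_of S (s \<otimes> t) (t\<^sup>\<star> \<otimes> s\<^sup>\<star>)"
    using 1 by (simp add: inverse_of_def)
qed simp

lemma conj_idem:
  assumes e: "e \<in> idems S" and [simp]: "s \<in> carrier S"
  shows "s\<^sup>\<star> \<otimes> e \<otimes> s \<in> idems S"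
proof (rule idemsI)
  have [simp]: "e \<in> carrier S" "e \<otimes> e = e" using e by auto
  show "s\<^sup>\<star> \<otimes> e \<otimes> s \<in> carrier S" by simp
  have "s\<^sup>\<star> \<otimes> e \<otimes> s \<otimes> (s\<^sup>\<star> \<otimes> e \<otimes> s) = s\<^sup>\<star> \<otimes> (e \<otimes> (s \<otimes> s\<^sup>\<star>)) \<otimes> e \<otimes> s"
    by (simp add: m_assoc)
  also have "\<dots> = s\<^sup>\<star> \<otimes> ((s \<otimes> s\<^sup>\<star>) \<otimes> e) \<otimes> e \<otimes> s"
    using idems_commute[OF e range_idem[of s]] by simp
  also have "\<dots> = s\<^sup>\<star> \<otimes> e \<otimes> s" by (simp add: m_assoc idem_absorb[OF e])
  finally show "s\<^sup>\<star> \<otimes> e \<otimes> s \<otimes> (s\<^sup>\<star> \<otimes> e \<otimes> s) = s\<^sup>\<star> \<otimes> e \<otimes> s" .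
qed

text \<open>Idempotents can be moved from the left of an element to its right at the price of a
  conjugation; this makes the left and right versions of the natural order coincide.\<close>

lemma idem_mult_eq_mult_conj:
  assumes e: "e \<in> idems S" and [simp]: "s \<in> carrier S"
  shows "e \<otimes> s = s \<otimes> (s\<^sup>\<star> \<otimes> e \<otimes> s)"
proof -
  have [simp]: "e \<in> carrier S" using e by auto
  have "s \<otimes> (s\<^sup>\<star> \<otimes> e \<otimes> s) = (s \<otimes> s\<^sup>\<star>) \<otimes> e \<otimes> s" by (simp add: m_assoc)
  also have "\<dots> = e \<otimes> (s \<otimes> s\<^sup>\<star>) \<otimes> s" using idems_commute[OF e range_idem[of s]] by simp
  finally show ?thesis by (simp add: m_assoc)
qed

lemma mult_idem_nle:
  assumes e: "e \<in> idems S" and [simp]: "t \<in> carrier S"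
  shows "t \<otimes> e \<preceq> t"
proof -
  have [simp]: "e \<in> carrier S" "e \<otimes> e = e" using e by auto
  have "t \<otimes> (t \<otimes> e)\<^sup>\<star> \<otimes> (t \<otimes> e) = t \<otimes> (e \<otimes> (t\<^sup>\<star> \<otimes> t)) \<otimes> e"
    by (simp add: sinv_mult sinv_idem[OF e] m_assoc)
  also have "\<dots> = t \<otimes> e"
    using idems_commute[OF e domain_idem[of t]] by (simp add: m_assoc)
  finally show ?thesis by (simp add: nle_iff)
qed

lemma idem_mult_nle:
  assumes e: "e \<in> idems S" and [simp]: "t \<in> carrier S"
  shows "e \<otimes> t \<preceq> t"
  using mult_idem_nle[OF conj_idem[OF assms]] idem_mult_eq_mult_conj[OF assms] by simp

lemma nleE:
  assumes "s \<preceq> t" "s \<in> carrier S" "t \<in> carrier S"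
  obtains e where "e \<in> idems S" "s = t \<otimes> e"
proof
  show "s\<^sup>\<star> \<otimes> s \<in> idems S" using assms by simp
  have "s = t \<otimes> s\<^sup>\<star> \<otimes> s" using assms(1) by (simp add: nle_iff)
  then show "s = t \<otimes> (s\<^sup>\<star> \<otimes> s)" using assms by (metis m_assoc sinv_closed)
qed

lemma nle_refl [simp]: "s \<in> carrier S \<Longrightarrow> s \<preceq> s"
  using mult_idem_nle[OF one_idem] by simp

lemma nle_trans [trans]:
  assumes "s \<preceq> t" "t \<preceq> u" and c: "s \<in> carrier S" "t \<in> carrier S" "u \<in> carrier S"
  shows "s \<preceq> u"
proof -
  obtain e where e: "e \<in> idems S" "s = t \<otimes> e" using nleE assms(1) c by metis
  obtain f where f: "f \<in> idems S" "t = u \<otimes> f" using nleE assms(2) c by metis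
  have "s = u \<otimes> (f \<otimes> e)" using e f c by (auto simp: m_assoc idemsD)
  then show ?thesis using mult_idem_nle[OF mult_idems_idem[OF f(1) e(1)]] c by simp
qed

lemma nle_sinv_mono:
  assumes "s \<preceq> t" and c: "s \<in> carrier S" "t \<in> carrier S"
  shows "s\<^sup>\<star> \<preceq> t\<^sup>\<star>"
proof -
  obtain e where e: "e \<in> idems S" "s = t \<otimes> e" using nleE assms by metis
  then have "s\<^sup>\<star> = e \<otimes> t\<^sup>\<star>" using c by (simp add: sinv_mult sinv_idem idemsD(1))
  then show ?thesis using idem_mult_nle[OF e(1)] c by simp
qed

lemma nle_mult_mono:
  assumes "s \<preceq> t" "u \<preceq> v"
    and c: "s \<in> carrier S" "t \<in> carrier S" "u \<in> carrier S" "v \<in> carrier S"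
  shows "s \<otimes> u \<preceq> t \<otimes> v"
proof -
  obtain e where e: "e \<in> idems S" "s = t \<otimes> e" using nleE assms(1) c by metis
  obtain f where f: "f \<in> idems S" "u = v \<otimes> f" using nleE assms(2) c by metis
  have [simp]: "e \<in> carrier S" "f \<in> carrier S" using e f by auto
  have "s \<otimes> u = t \<otimes> (e \<otimes> v) \<otimes> f" using e f c by (simp add: m_assoc)
  also have "\<dots> = t \<otimes> v \<otimes> (v\<^sup>\<star> \<otimes> e \<otimes> v \<otimes> f)"
    unfolding idem_mult_eq_mult_conj[OF e(1) c(4)] using c by (simp add: m_assoc)
  finally show ?thesis
    using mult_idem_nle[OF mult_idems_idem[OF conj_idem[OF e(1) c(4)] f(1)], of "t \<otimes> v"] c by simp
qed

lemma idem_down_closed: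
  assumes "s \<preceq> e" "s \<in> carrier S" "e \<in> idems S"
  shows "s \<in> idems S"
proof -
  obtain f where "f \<in> idems S" "s = e \<otimes> f" using nleE assms by (metis idemsD(1))
  then show ?thesis using mult_idems_idem assms by simp
qed

lemma nle_idem_iff:
  assumes "e \<in> idems S" "f \<in> idems S"
  shows "e \<preceq> f \<longleftrightarrow> e = e \<otimes> f"
proof -
  have "f \<otimes> e \<otimes> e = f \<otimes> e" using assms by (metis idemsD m_assoc)
  then show ?thesis
    using idems_commute[OF assms] by (simp add: nle_iff sinv_idem[OF assms(1)])
qed

lemma nle_idem_mult:
  assumes "g \<preceq> e" "g \<preceq> f" "g \<in> carrier S" "e \<in> idems S" "f \<in> idems S"
  shows "g \<preceq> e \<otimes> f"
proof -
  have g: "g \<in> idems S" using idem_down_closed assms by blast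
  have "g = g \<otimes> e" "g = g \<otimes> f" using assms g nle_idem_iff by auto
  then have "g = g \<otimes> (e \<otimes> f)" using assms by (metis idemsD(1) m_assoc)
  then show ?thesis using nle_idem_iff[OF g mult_idems_idem] assms by simp
qed

lemma domain_mono:
  assumes "s \<preceq> t" "s \<in> carrier S" "t \<in> carrier S"
  shows "s\<^sup>\<star> \<otimes> s \<preceq> t\<^sup>\<star> \<otimes> t"
  using assms by (simp add: nle_mult_mono nle_sinv_mono)

lemma range_mono:
  assumes "s \<preceq> t" "s \<in> carrier S" "t \<in> carrier S"
  shows "s \<otimes> s\<^sup>\<star> \<preceq> t \<otimes> t\<^sup>\<star>"
  using assms by (simp add: nle_mult_mono nle_sinv_mono)

lemma nle_zero:
  assumes "is_zero S z" "s \<preceq> z" "s \<in> carrier S"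
  shows "s = z"
  using assms by (simp add: nle_iff is_zero_def)

lemma zero_unique: "is_zero S y \<Longrightarrow> is_zero S z \<Longrightarrow> y = z"
  by (metis is_zero_def)

lemma domain_eq_zero:
  assumes "is_zero S z" "s \<in> carrier S" "s\<^sup>\<star> \<otimes> s = z"
  shows "s = z"
  using assms mult_sinv_mult(1)[of s] by (simp add: is_zero_def)

lemma zero_idem: "is_zero S z \<Longrightarrow> z \<in> idems S"
  by (auto intro!: idemsI simp: is_zero_def)

end

section \<open>Domain and range of a filter\<close>

context inverse_monoid
begin

lemma is_meet_iff:
  assumes "a \<in> carrier S" "b \<in> carrier S"
  shows "is_meet S m a b \<longleftrightarrow> m \<in> carrier S \<and> m \<preceq> a \<and> m \<preceq> b \<and>
    (\<forall>c\<in>carrier S. c \<preceq> a \<longrightarrow> c \<preceq> b \<longrightarrow> c \<preceq> m)"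
  using assms unfolding is_meet_def greatest_def Lower_def
  by (auto simp: nat_order_def)

lemma filter_carrier: "proper_filter S A \<Longrightarrow> a \<in> A \<Longrightarrow> a \<in> carrier S"
  by (auto simp: proper_filter_def)

lemma filter_up: "proper_filter S A \<Longrightarrow> a \<in> A \<Longrightarrow> a \<preceq> t \<Longrightarrow> t \<in> carrier S \<Longrightarrow> t \<in> A"
  by (auto simp: proper_filter_def)

lemma filter_not_zero: "proper_filter S A \<Longrightarrow> is_zero S z \<Longrightarrow> z \<notin> A"
  by (auto simp: proper_filter_def)

lemma filter_lower:
  assumes A: "proper_filter S A" and ab: "a \<in> A" "b \<in> A"
  obtains c where "c \<in> A" "c \<in> carrier S" "c \<preceq> a" "c \<preceq> b"
proof -
  obtain m where "m \<in> A" "is_meet S m a b" using A ab unfolding proper_filter_def by blast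
  then show thesis using that is_meet_iff[of a b m] filter_carrier[OF A] ab by simp
qed

lemma filter_mult_idems:
  assumes A: "proper_filter S A" and e: "e \<in> A" "e \<in> idems S" and f: "f \<in> A" "f \<in> idems S"
  shows "e \<otimes> f \<in> A"
proof -
  obtain c where c: "c \<in> A" "c \<in> carrier S" "c \<preceq> e" "c \<preceq> f"
    by (rule filter_lower[OF A e(1) f(1)])
  then have "c \<preceq> e \<otimes> f" using nle_idem_mult e f by blast
  then show ?thesis using filter_up[OF A c(1)] e f by blast
qed

lemma up_closureI: "a \<in> D \<Longrightarrow> a \<preceq> t \<Longrightarrow> t \<in> carrier S \<Longrightarrow> t \<in> up_closure S D"
  by (auto simp: up_closure_def)

lemma up_closure_superset: "D \<subseteq> carrier S \<Longrightarrow> D \<subseteq> up_closure S D"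
  by (blast intro: up_closureI nle_refl)

lemma up_closure_eqI:
  assumes "\<And>x. x \<in> X \<Longrightarrow> \<exists>y\<in>Y. y \<preceq> x" "\<And>y. y \<in> Y \<Longrightarrow> \<exists>x\<in>X. x \<preceq> y"
    and "X \<subseteq> carrier S" "Y \<subseteq> carrier S"
  shows "up_closure S X = up_closure S Y"
  using assms unfolding up_closure_def by (blast intro: nle_trans)

text \<open>The groupoid operations use all products of two elements of the filter. The diagonal
  products below generate the same filters, since two elements of a filter have a common
  lower bound in it and multiplication is monotone.\<close>

definition filter_dom :: "'a set \<Rightarrow> 'a set" where
  "filter_dom A = up_closure S ((\<lambda>c. c\<^sup>\<star> \<otimes> c) ` A)"

lemma filter_domI:
  "c \<in> A \<Longrightarrow> c\<^sup>\<star> \<otimes> c \<preceq> t \<Longrightarrow> t \<in> carrier S \<Longrightarrow> t \<in> filter_dom A"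
  unfolding filter_dom_def by (rule up_closureI) auto

definition filter_cod :: "'a set \<Rightarrow> 'a set" where
  "filter_cod A = up_closure S ((\<lambda>c. c \<otimes> c\<^sup>\<star>) ` A)"

lemma filter_codI:
  "c \<in> A \<Longrightarrow> c \<otimes> c\<^sup>\<star> \<preceq> t \<Longrightarrow> t \<in> carrier S \<Longrightarrow> t \<in> filter_cod A"
  unfolding filter_cod_def by (rule up_closureI) auto

lemma filter_dom_eq:
  assumes A: "proper_filter S A"
  shows "up_closure S (sinv S ` A <#> A) = filter_dom A"
  unfolding filter_dom_def
proof (rule up_closure_eqI)
  note [simp] = filter_carrier[OF A]
  fix x assume "x \<in> sinv S ` A <#> A"
  then obtain p q where x: "x = p\<^sup>\<star> \<otimes> q" "p \<in> A" "q \<in> A" by (auto simp: set_mult_def)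
  then obtain c where c: "c \<in> A" "c \<preceq> p" "c \<preceq> q" using filter_lower[OF A x(2,3)] by metis
  then have "c\<^sup>\<star> \<otimes> c \<preceq> x" using x by (simp add: nle_mult_mono nle_sinv_mono)
  then show "\<exists>y\<in>(\<lambda>c. c\<^sup>\<star> \<otimes> c) ` A. y \<preceq> x" using c by blast
next
  note [simp] = filter_carrier[OF A]
  fix y assume "y \<in> (\<lambda>c. c\<^sup>\<star> \<otimes> c) ` A"
  then obtain c where c: "c \<in> A" "y = c\<^sup>\<star> \<otimes> c" by blast
  then have "y \<in> sinv S ` A <#> A" "y \<preceq> y" by (auto simp: set_mult_def)
  then show "\<exists>x\<in>sinv S ` A <#> A. x \<preceq> y" by blast
qed (auto simp: set_mult_def filter_carrier[OF A])

lemma filter_cod_eq: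
  assumes A: "proper_filter S A"
  shows "up_closure S (A <#> sinv S ` A) = filter_cod A"
  unfolding filter_cod_def
proof (rule up_closure_eqI)
  note [simp] = filter_carrier[OF A]
  fix x assume "x \<in> A <#> sinv S ` A"
  then obtain p q where x: "x = p \<otimes> q\<^sup>\<star>" "p \<in> A" "q \<in> A" by (auto simp: set_mult_def)
  then obtain c where c: "c \<in> A" "c \<preceq> p" "c \<preceq> q" using filter_lower[OF A x(2,3)] by metis
  then have "c \<otimes> c\<^sup>\<star> \<preceq> x" using x by (simp add: nle_mult_mono nle_sinv_mono)
  then show "\<exists>y\<in>(\<lambda>c. c \<otimes> c\<^sup>\<star>) ` A. y \<preceq> x" using c by blast
next
  note [simp] = filter_carrier[OF A]
  fix y assume "y \<in> (\<lambda>c. c \<otimes> c\<^sup>\<star>) ` A"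
  then obtain c where c: "c \<in> A" "y = c \<otimes> c\<^sup>\<star>" by blast
  then have "y \<in> A <#> sinv S ` A" "y \<preceq> y" by (auto simp: set_mult_def)
  then show "\<exists>x\<in>A <#> sinv S ` A. x \<preceq> y" by blast
qed (auto simp: set_mult_def filter_carrier[OF A])

lemma Iso_ultrafilter_groupoid:
  "Iso (ultrafilter_groupoid S) = {A. ultrafilter S A \<and> filter_dom A = filter_cod A}"
  unfolding Iso_def ultrafilter_groupoid_def
  by (auto simp: ultrafilter_def filter_dom_eq filter_cod_eq)

lemma identities_ultrafilter_groupoid:
  "identities (ultrafilter_groupoid S) = filter_dom ` {A. ultrafilter S A}"
  unfolding identities_def ultrafilter_groupoid_def
  by (auto simp: ultrafilter_def filter_dom_eq intro!: image_cong)

lemma filter_below_idem: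
  assumes A: "proper_filter S A" and e: "e \<in> A" "e \<in> idems S" and x: "x \<in> A"
  obtains f where "f \<in> A" "f \<in> idems S" "f \<preceq> x"
proof -
  obtain c where c: "c \<in> A" "c \<in> carrier S" "c \<preceq> x" "c \<preceq> e" by (rule filter_lower[OF A x e(1)])
  then show thesis using that idem_down_closed[OF c(4,2) e(2)] by blast
qed

text \<open>Below an idempotent there are only idempotents, so such a filter is generated by its
  idempotents, and for an idempotent \<open>f\<close> the generator \<open>f\<^sup>\<star> f\<close> of the domain is \<open>f\<close>.\<close>

lemma filter_dom_with_idem:
  assumes A: "proper_filter S A" and e: "e \<in> A" "e \<in> idems S"
  shows "filter_dom A = A"
proof -
  note [simp] = filter_carrier[OF A]
  have 0: "A = up_closure S A"
  proof (rule equalityI)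
    show "A \<subseteq> up_closure S A" by (rule up_closure_superset) auto
    show "up_closure S A \<subseteq> A" using filter_up[OF A] by (auto simp: up_closure_def)
  qed
  have 1: "f\<^sup>\<star> \<otimes> f = f" if "f \<in> idems S" for f
    using that by (auto simp: sinv_idem)
  have "filter_dom A = up_closure S A" unfolding filter_dom_def
  proof (rule up_closure_eqI)
    fix x assume "x \<in> (\<lambda>c. c\<^sup>\<star> \<otimes> c) ` A"
    then obtain c where c: "c \<in> A" "x = c\<^sup>\<star> \<otimes> c" by blast
    obtain f where "f \<in> A" "f \<in> idems S" "f \<preceq> c" using filter_below_idem[OF A e c(1)] by metis
    then show "\<exists>y\<in>A. y \<preceq> x" using c domain_mono[of f c] 1[of f] by auto
  next
    fix y assume y: "y \<in> A"
    obtain f where "f \<in> A" "f \<in> idems S" "f \<preceq> y" using filter_below_idem[OF A e y] by metis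
    then show "\<exists>x\<in>(\<lambda>c. c\<^sup>\<star> \<otimes> c) ` A. x \<preceq> y" using 1[of f] by (auto intro!: bexI[of _ f])
  qed auto
  then show ?thesis using 0 by simp
qed

lemma filter_dom_contains_idem:
  assumes A: "proper_filter S A"
  shows "\<exists>e\<in>filter_dom A. e \<in> idems S"
proof -
  obtain a where a: "a \<in> A" "a \<in> carrier S" using A by (auto simp: proper_filter_def)
  then have "a\<^sup>\<star> \<otimes> a \<in> filter_dom A" by (intro filter_domI[of a]) auto
  then show ?thesis using a by blast
qed

text \<open>Commuting \<open>a\<close> past \<open>a\<^sup>\<star> a\<close> and past \<open>a a\<^sup>\<star>\<close> shows that each of these idempotents lies below
  the other.\<close>

lemma commute_domain_eq_range:
  assumes [simp]: "a \<in> carrier S" and com: "\<And>e. e \<in> idems S \<Longrightarrow> a \<otimes> e = e \<otimes> a"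
  shows "a\<^sup>\<star> \<otimes> a = a \<otimes> a\<^sup>\<star>"
proof -
  let ?d = "a\<^sup>\<star> \<otimes> a" and ?r = "a \<otimes> a\<^sup>\<star>"
  have da: "?d \<otimes> a = a" using com[of ?d] by simp
  have ar: "a \<otimes> ?r = a" using com[of ?r] by (simp add: m_assoc)
  have "?d \<otimes> ?r = (?d \<otimes> a) \<otimes> a\<^sup>\<star>" by (simp add: m_assoc)
  then have 1: "?d \<otimes> ?r = ?r" by (simp only: da)
  have "?d \<otimes> ?r = a\<^sup>\<star> \<otimes> (a \<otimes> ?r)" by (simp add: m_assoc)
  then have "?d \<otimes> ?r = ?d" by (simp only: ar)
  with 1 show ?thesis by simp
qed

lemma commute_below:
  assumes [simp]: "a \<in> carrier S" "c \<in> carrier S"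
    and com: "\<And>e. e \<in> idems S \<Longrightarrow> a \<otimes> e = e \<otimes> a" and "c \<preceq> a"
  shows "c\<^sup>\<star> \<otimes> c = c \<otimes> c\<^sup>\<star>"
proof (rule commute_domain_eq_range)
  obtain f where f: "f \<in> idems S" "c = a \<otimes> f" using nleE assms(1,2,4) by metis
  have [simp]: "f \<in> carrier S" using f by auto
  fix e assume e: "e \<in> idems S"
  then have [simp]: "e \<in> carrier S" by auto
  have "c \<otimes> e = a \<otimes> e \<otimes> f" using f idems_commute[OF e f(1)] by (simp add: m_assoc)
  then show "c \<otimes> e = e \<otimes> c" using f com[OF e] by (simp add: m_assoc)
qed simp

text \<open>The elements of the filter below \<open>a\<close> generate it, and each of them has equal domain
  and range.\<close>

lemma filter_dom_eq_cod_if_commute: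
  assumes A: "proper_filter S A" and a: "a \<in> A"
    and com: "\<And>e. e \<in> idems S \<Longrightarrow> a \<otimes> e = e \<otimes> a"
  shows "filter_dom A = filter_cod A"
  unfolding filter_dom_def filter_cod_def
proof (rule up_closure_eqI)
  note [simp] = filter_carrier[OF A]
  have ac: "a \<in> carrier S" using a by simp
  fix x assume "x \<in> (\<lambda>c. c\<^sup>\<star> \<otimes> c) ` A"
  then obtain b where b: "b \<in> A" "x = b\<^sup>\<star> \<otimes> b" by blast
  obtain c where c: "c \<in> A" "c \<preceq> b" "c \<preceq> a" using filter_lower[OF A b(1) a] by metis
  then have "c \<otimes> c\<^sup>\<star> \<preceq> x"
    using b domain_mono[of c b] commute_below[OF ac _ com, of c] by simp
  then show "\<exists>y\<in>(\<lambda>c. c \<otimes> c\<^sup>\<star>) ` A. y \<preceq> x" using c by blast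
next
  note [simp] = filter_carrier[OF A]
  have ac: "a \<in> carrier S" using a by simp
  fix x assume "x \<in> (\<lambda>c. c \<otimes> c\<^sup>\<star>) ` A"
  then obtain b where b: "b \<in> A" "x = b \<otimes> b\<^sup>\<star>" by blast
  obtain c where c: "c \<in> A" "c \<preceq> b" "c \<preceq> a" using filter_lower[OF A b(1) a] by metis
  then have "c\<^sup>\<star> \<otimes> c \<preceq> x"
    using b range_mono[of c b] commute_below[OF ac _ com, of c] by simp
  then show "\<exists>y\<in>(\<lambda>c. c\<^sup>\<star> \<otimes> c) ` A. y \<preceq> x" using c by blast
qed (auto simp: filter_carrier[OF A])

text \<open>If \<open>b b\<^sup>\<star>\<close> belonged to the domain, some \<open>c \<le> b\<close> in the filter would have its
  domain below both \<open>b\<^sup>\<star> b\<close> and \<open>b b\<^sup>\<star>\<close>, hence would be zero.\<close>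

lemma filter_dom_cod_not_orthogonal:
  assumes A: "proper_filter S A" and b: "b \<in> A"
    and orth: "is_zero S ((b\<^sup>\<star> \<otimes> b) \<otimes> (b \<otimes> b\<^sup>\<star>))" (is "is_zero S ?z")
  shows "filter_dom A \<noteq> filter_cod A"
proof
  note [simp] = filter_carrier[OF A]
  assume eq: "filter_dom A = filter_cod A"
  have "b \<otimes> b\<^sup>\<star> \<in> filter_dom A"
    unfolding eq using b by (intro filter_codI[of b]) auto
  then obtain x where x: "x \<in> A" "x\<^sup>\<star> \<otimes> x \<preceq> b \<otimes> b\<^sup>\<star>"
    by (auto simp: filter_dom_def up_closure_def)
  obtain c where c: "c \<in> A" "c \<preceq> x" "c \<preceq> b" using filter_lower[OF A x(1) b] by metis
  have "c\<^sup>\<star> \<otimes> c \<preceq> b \<otimes> b\<^sup>\<star>"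
    using nle_trans[OF domain_mono[OF c(2)] x(2)] b c(1) x(1) by simp
  moreover have "c\<^sup>\<star> \<otimes> c \<preceq> b\<^sup>\<star> \<otimes> b" using domain_mono[OF c(3)] b c(1) by simp
  ultimately have "c\<^sup>\<star> \<otimes> c \<preceq> ?z"
    using nle_idem_mult[of "c\<^sup>\<star> \<otimes> c" "b\<^sup>\<star> \<otimes> b" "b \<otimes> b\<^sup>\<star>"] b c(1) by simp
  then have "c\<^sup>\<star> \<otimes> c = ?z" by (rule nle_zero[OF orth]) (use c(1) in simp)
  then have "c = ?z" by (rule domain_eq_zero[OF orth, rotated]) (use c(1) in simp)
  then show False using filter_not_zero[OF A orth] c(1) by simp
qed

end

section \<open>Existence of ultrafilters, and their domains\<close>

context boolean_inverse_meet_monoid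
begin

text \<open>A filter must contain the meet of any two of its elements, not just a common lower bound.
  Since all meets exist, the meet lies above any lower bound, so downward directedness of a
  generating set suffices.\<close>

lemma proper_filter_up_closure:
  assumes D: "D \<subseteq> carrier S" "D \<noteq> {}" and z: "\<And>z. is_zero S z \<Longrightarrow> z \<notin> D"
    and dir: "\<And>a b. a \<in> D \<Longrightarrow> b \<in> D \<Longrightarrow> \<exists>c\<in>D. c \<preceq> a \<and> c \<preceq> b"
  shows "proper_filter S (up_closure S D)"
  unfolding proper_filter_def
proof (intro conjI allI impI ballI)
  show "up_closure S D \<subseteq> carrier S" by (auto simp: up_closure_def)
  show "up_closure S D \<noteq> {}" using up_closure_superset D by blast
next
  fix y assume y: "is_zero S y"
  show "y \<notin> up_closure S D"
    using z[OF y] nle_zero[OF y] D by (auto simp: up_closure_def)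
next
  fix a b assume "a \<in> up_closure S D" "b \<in> up_closure S D"
  then obtain p q where pq: "a \<in> carrier S" "b \<in> carrier S" "p \<in> D" "q \<in> D" "p \<preceq> a" "q \<preceq> b"
    by (auto simp: up_closure_def)
  obtain c where c: "c \<in> D" "c \<preceq> p" "c \<preceq> q" using dir pq by blast
  have "c \<preceq> a" "c \<preceq> b" using nle_trans c pq D by blast+
  moreover obtain m where "is_meet S m a b" using meet_ex pq by blast
  ultimately show "\<exists>m\<in>up_closure S D. is_meet S m a b"
    using is_meet_iff[OF pq(1,2)] c D by (blast intro: up_closureI)
next
  fix a t assume "a \<in> up_closure S D" "t \<in> carrier S" "a \<preceq> t"
  then show "t \<in> up_closure S D" using D by (auto simp: up_closure_def intro: nle_trans)
qed

text \<open>Zorn's lemma, applied to the proper filters containing \<open>b\<close>; one of them is the principal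
  filter, which is proper because \<open>b\<close> is nonzero.\<close>

lemma ultrafilter_exists:
  assumes b: "b \<in> carrier S" "\<not> is_zero S b"
  obtains A where "ultrafilter S A" "b \<in> A"
proof -
  let ?F = "{A. proper_filter S A \<and> b \<in> A}"
  have "proper_filter S (up_closure S {b})" "b \<in> up_closure S {b}"
    using b by (auto intro!: proper_filter_up_closure up_closureI[of b])
  then have ne: "?F \<noteq> {}" by blast
  have "\<exists>M\<in>?F. \<forall>X\<in>?F. M \<subseteq> X \<longrightarrow> X = M"
  proof (rule subset_Zorn_nonempty[OF ne])
    fix C assume C: "C \<noteq> {}" "subset.chain ?F C"
    then have F: "\<And>X. X \<in> C \<Longrightarrow> proper_filter S X \<and> b \<in> X"
      and ch: "\<And>X Y. X \<in> C \<Longrightarrow> Y \<in> C \<Longrightarrow> X \<subseteq> Y \<or> Y \<subseteq> X"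
      by (auto simp: subset_chain_def)
    have "\<exists>m\<in>\<Union>C. is_meet S m x y" if "x \<in> \<Union>C" "y \<in> \<Union>C" for x y
    proof -
      obtain X Y where XY: "X \<in> C" "Y \<in> C" "x \<in> X" "y \<in> Y" using \<open>x \<in> \<Union>C\<close> \<open>y \<in> \<Union>C\<close> by blast
      then obtain Z where "Z \<in> C" "x \<in> Z" "y \<in> Z" using ch by blast
      then show ?thesis using F unfolding proper_filter_def by blast
    qed
    then have "proper_filter S (\<Union>C)"
      unfolding proper_filter_def
    proof (intro conjI)
      show "\<Union>C \<subseteq> carrier S" using F filter_carrier by blast
      show "\<Union>C \<noteq> {}" using F C(1) by blast
      show "\<forall>z. is_zero S z \<longrightarrow> z \<notin> \<Union>C" using F filter_not_zero by blast
      show "\<forall>a\<in>\<Union>C. \<forall>t\<in>carrier S. a \<preceq> t \<longrightarrow> t \<in> \<Union>C" using F filter_up by blast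
    qed blast
    then show "\<Union>C \<in> ?F" using F C(1) by blast
  qed
  then obtain M where M: "proper_filter S M" "b \<in> M"
    and max: "\<And>X. proper_filter S X \<Longrightarrow> b \<in> X \<Longrightarrow> M \<subseteq> X \<Longrightarrow> X = M" by blast
  then have "ultrafilter S M" unfolding ultrafilter_def by blast
  then show thesis using that M(2) by blast
qed

text \<open>A proper filter \<open>F\<close> above the domain of \<open>A\<close> can be transported along \<open>A\<close>: the products
  \<open>x f\<close> with \<open>x \<in> A\<close> and \<open>f \<in> F\<close> idempotent generate a proper filter containing \<open>A\<close>.
  Maximality of \<open>A\<close> puts \<open>x f\<close> in \<open>A\<close>, and then \<open>f\<close> lies above the domain of an element
  of \<open>A\<close>.\<close>

lemma ultrafilter_filter_dom:
  assumes U: "ultrafilter S A"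
  shows "ultrafilter S (filter_dom A)"
proof -
  have A: "proper_filter S A" and max: "\<And>B. proper_filter S B \<Longrightarrow> A \<subseteq> B \<Longrightarrow> B = A"
    using U by (auto simp: ultrafilter_def)
  note [simp] = filter_carrier[OF A]
  have Ane: "A \<noteq> {}" using A by (simp add: proper_filter_def)
  have "proper_filter S (filter_dom A)" unfolding filter_dom_def
  proof (rule proper_filter_up_closure)
    fix z assume z: "is_zero S z"
    show "z \<notin> (\<lambda>c. c\<^sup>\<star> \<otimes> c) ` A"
    proof
      assume "z \<in> (\<lambda>c. c\<^sup>\<star> \<otimes> c) ` A"
      then obtain c where c: "c \<in> A" "c\<^sup>\<star> \<otimes> c = z" by blast
      then have "c = z" using domain_eq_zero[OF z] by simp
      then show False using filter_not_zero[OF A z] c(1) by simp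
    qed
  next
    fix x y assume "x \<in> (\<lambda>c. c\<^sup>\<star> \<otimes> c) ` A" "y \<in> (\<lambda>c. c\<^sup>\<star> \<otimes> c) ` A"
    then obtain p q where pq: "p \<in> A" "q \<in> A" "x = p\<^sup>\<star> \<otimes> p" "y = q\<^sup>\<star> \<otimes> q" by blast
    obtain c where c: "c \<in> A" "c \<in> carrier S" "c \<preceq> p" "c \<preceq> q"
      by (rule filter_lower[OF A pq(1,2)])
    then have "c\<^sup>\<star> \<otimes> c \<preceq> x" "c\<^sup>\<star> \<otimes> c \<preceq> y" using pq domain_mono by simp_all
    then show "\<exists>c\<in>(\<lambda>c. c\<^sup>\<star> \<otimes> c) ` A. c \<preceq> x \<and> c \<preceq> y" using c(1) by blast
  next
    show "(\<lambda>c. c\<^sup>\<star> \<otimes> c) ` A \<subseteq> carrier S" by auto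
    show "(\<lambda>c. c\<^sup>\<star> \<otimes> c) ` A \<noteq> {}" using Ane by simp
  qed
  moreover have "F = filter_dom A" if F: "proper_filter S F" and sub: "filter_dom A \<subseteq> F" for F
  proof
    have dF: "c\<^sup>\<star> \<otimes> c \<in> F" if "c \<in> A" for c
      using that sub filter_domI[of c A "c\<^sup>\<star> \<otimes> c"] by auto
    let ?D = "{x \<otimes> f | x f. x \<in> A \<and> f \<in> F \<and> f \<in> idems S}"
    have "proper_filter S (up_closure S ?D)"
    proof (rule proper_filter_up_closure)
      show "?D \<subseteq> carrier S" by auto
      show "?D \<noteq> {}" using Ane dF domain_idem[OF filter_carrier[OF A]] by blast
    next
      fix z assume z: "is_zero S z"
      show "z \<notin> ?D"
      proof
        assume "z \<in> ?D"
        then obtain x f where xf: "z = x \<otimes> f" "x \<in> A" "f \<in> F" "f \<in> idems S" by blast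
        have "x\<^sup>\<star> \<otimes> x \<otimes> f = x\<^sup>\<star> \<otimes> z" using xf by (auto simp: m_assoc)
        also have "\<dots> = z" using z xf by (simp add: is_zero_def)
        \<comment> \<open>Both \<open>x\<^sup>\<star> \<otimes> x\<close> and \<open>f\<close> lie in \<open>F\<close>, hence so does their product.\<close>
        finally have "z \<in> F" using filter_mult_idems[OF F dF[OF xf(2)] _ xf(3,4)] xf by simp
        then show False using filter_not_zero[OF F z] by simp
      qed
    next
      fix a b assume "a \<in> ?D" "b \<in> ?D"
      then obtain x f y g where a: "a = x \<otimes> f" "x \<in> A" "f \<in> F" "f \<in> idems S"
        and b: "b = y \<otimes> g" "y \<in> A" "g \<in> F" "g \<in> idems S" by blast
      obtain c where c: "c \<in> A" "c \<preceq> x" "c \<preceq> y" by (rule filter_lower[OF A a(2) b(2)])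
      obtain h where h: "h \<in> F" "h \<in> carrier S" "h \<preceq> f" "h \<preceq> g"
        by (rule filter_lower[OF F a(3) b(3)])
      have "h \<in> idems S" using idem_down_closed h a by blast
      moreover have "c \<otimes> h \<preceq> a" "c \<otimes> h \<preceq> b"
        using a b c h by (auto intro!: nle_mult_mono)
      ultimately show "\<exists>c\<in>?D. c \<preceq> a \<and> c \<preceq> b" using c h by blast
    qed
    moreover have "A \<subseteq> up_closure S ?D"
    proof
      fix x assume x: "x \<in> A"
      then have "x \<otimes> (x\<^sup>\<star> \<otimes> x) \<in> ?D" using dF domain_idem[OF filter_carrier[OF A]] by blast
      then have "x \<in> ?D" using x by (simp only: mult_sinv_mult filter_carrier[OF A])
      then show "x \<in> up_closure S ?D" using x by (intro up_closureI[of x]) auto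
    qed
    ultimately have eq: "up_closure S ?D = A" by (rule max)
    obtain a where a: "a \<in> A" using Ane by blast
    show "F \<subseteq> filter_dom A"
    proof
      fix p assume p: "p \<in> F"
      obtain f where f: "f \<in> F" "f \<in> idems S" "f \<preceq> p"
        using filter_below_idem[OF F dF[OF a] _ p] a by auto
      have [simp]: "f \<in> carrier S" "p \<in> carrier S" "f \<otimes> f = f"
        using f filter_carrier[OF F] p by auto
      have "a \<otimes> f \<in> ?D" using a f by blast
      moreover have "?D \<subseteq> up_closure S ?D" by (rule up_closure_superset) auto
      ultimately have af: "a \<otimes> f \<in> A" using eq by blast
      have "(a \<otimes> f)\<^sup>\<star> \<otimes> (a \<otimes> f) = f \<otimes> (a\<^sup>\<star> \<otimes> a) \<otimes> f"
        using a by (simp add: sinv_mult sinv_idem[OF f(2)] m_assoc)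
      also have "\<dots> = (a\<^sup>\<star> \<otimes> a) \<otimes> f"
        using a idems_commute[OF f(2) domain_idem[of a]] by (simp add: m_assoc)
      also have "\<dots> \<preceq> f" using a by (auto intro: idem_mult_nle)
      finally have "(a \<otimes> f)\<^sup>\<star> \<otimes> (a \<otimes> f) \<preceq> f" .
      from nle_trans[OF this f(3)] have "(a \<otimes> f)\<^sup>\<star> \<otimes> (a \<otimes> f) \<preceq> p" using a by simp
      then show "p \<in> filter_dom A" using af by (auto intro: filter_domI)
    qed
  qed (fact sub)
  ultimately show ?thesis by (auto simp: ultrafilter_def)
qed

text \<open>The ultrafilters containing an idempotent are their own domains; conversely a domain
  contains \<open>a\<^sup>\<star> a\<close> and is again an ultrafilter.\<close>

lemma identities_iff_idem:
  "identities (ultrafilter_groupoid S) = {A. ultrafilter S A \<and> (\<exists>e\<in>A. e \<in> idems S)}"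
  unfolding identities_ultrafilter_groupoid
proof (intro equalityI subsetI)
  fix B assume "B \<in> filter_dom ` {A. ultrafilter S A}"
  then obtain A where A: "ultrafilter S A" "B = filter_dom A" by blast
  then have "proper_filter S A" by (simp add: ultrafilter_def)
  then show "B \<in> {A. ultrafilter S A \<and> (\<exists>e\<in>A. e \<in> idems S)}"
    using A ultrafilter_filter_dom[OF A(1)] filter_dom_contains_idem by simp
next
  fix A assume "A \<in> {A. ultrafilter S A \<and> (\<exists>e\<in>A. e \<in> idems S)}"
  then obtain e where A: "ultrafilter S A" "e \<in> A" "e \<in> idems S" by blast
  then have "filter_dom A = A" using filter_dom_with_idem by (simp add: ultrafilter_def)
  then show "A \<in> filter_dom ` {A. ultrafilter S A}" using A(1) by (metis imageI mem_Collect_eq)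
qed

end

section \<open>The topology and the interior of the isotropy\<close>

context boolean_inverse_meet_monoid
begin

lemma openin_basis:
  "a \<in> carrier S \<Longrightarrow> openin (gtop (ultrafilter_groupoid S)) (ultrafilters_at S a)"
  by (auto simp: ultrafilter_groupoid_def intro!: topology_generated_by_Basis)

text \<open>By induction on the generation of the open set. The intersection step holds because an
  ultrafilter containing \<open>a\<close> and \<open>b\<close> contains some \<open>c\<close> below both, and every ultrafilter
  through \<open>c\<close> passes through \<open>a\<close> and \<open>b\<close>.\<close>

lemma open_contains_basic:
  assumes "openin (gtop (ultrafilter_groupoid S)) T" "A \<in> T"
  shows "\<exists>a\<in>carrier S. A \<in> ultrafilters_at S a \<and> ultrafilters_at S a \<subseteq> T"
proof -
  have "generate_topology_on (ultrafilters_at S ` carrier S) T"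
    using assms(1) by (simp add: ultrafilter_groupoid_def openin_topology_generated_by_iff)
  then show ?thesis using assms(2)
  proof (induction arbitrary: A)
    case (Int U V)
    obtain a b where ab: "a \<in> carrier S" "A \<in> ultrafilters_at S a" "ultrafilters_at S a \<subseteq> U"
      "b \<in> carrier S" "A \<in> ultrafilters_at S b" "ultrafilters_at S b \<subseteq> V"
      using Int by (metis IntD1 IntD2)
    then have A: "proper_filter S A" "a \<in> A" "b \<in> A"
      by (auto simp: ultrafilters_at_def ultrafilter_def)
    obtain c where c: "c \<in> A" "c \<in> carrier S" "c \<preceq> a" "c \<preceq> b" using filter_lower[OF A] .
    have "ultrafilters_at S c \<subseteq> ultrafilters_at S a \<inter> ultrafilters_at S b"
      using c ab(1,4) filter_up by (auto simp: ultrafilters_at_def ultrafilter_def)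
    then show ?case using ab c by (intro bexI[of _ c]) (auto simp: ultrafilters_at_def)
  next
    case (UN K)
    then show ?case by (meson Union_iff Union_upper subset_trans)
  qed auto
qed

lemma interior_Iso_iff:
  "A \<in> (gtop (ultrafilter_groupoid S)) interior_of (Iso (ultrafilter_groupoid S)) \<longleftrightarrow>
    (\<exists>a\<in>carrier S. A \<in> ultrafilters_at S a \<and> ultrafilters_at S a \<subseteq> Iso (ultrafilter_groupoid S))"
    (is "?L \<longleftrightarrow> ?R")
proof
  assume ?L
  then obtain T where T: "openin (gtop (ultrafilter_groupoid S)) T" "A \<in> T"
    "T \<subseteq> Iso (ultrafilter_groupoid S)" by (auto simp: interior_of_def)
  then show ?R using open_contains_basic[OF T(1,2)] by (meson subset_trans)
next
  assume ?R
  then show ?L using openin_basis by (auto simp: interior_of_def)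
qed

end

section \<open>Complements of idempotents\<close>

context boolean_inverse_meet_monoid
begin

text \<open>The form in which complements are used: an idempotent disjoint from the complement of
  \<open>e\<close> lies below \<open>e\<close>. The proof identifies the lattice operations of the
  order of idempotents with multiplication, zero and one.\<close>

lemma idem_complement:
  assumes e: "e \<in> idems S" and z: "is_zero S z"
  obtains e' where "e' \<in> idems S" "e \<otimes> e' = z"
    "\<And>f. f \<in> idems S \<Longrightarrow> f \<otimes> e' = z \<Longrightarrow> f = f \<otimes> e"
proof -
  interpret B: boolean_lattice "idem_order S" by (rule idems_boolean)
  have [simp]: "carrier (idem_order S) = idems S"
    "\<And>x y. x \<sqsubseteq>\<^bsub>idem_order S\<^esub> y \<longleftrightarrow> x = x \<otimes> y"
    by (simp_all add: idem_order_def)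
  have meet: "x \<sqinter>\<^bsub>idem_order S\<^esub> y = x \<otimes> y" if x: "x \<in> idems S" and y: "y \<in> idems S" for x y
  proof -
    let ?m = "x \<sqinter>\<^bsub>idem_order S\<^esub> y"
    have m: "?m \<in> idems S" using B.meet_closed x y by simp
    have xy: "x \<otimes> y \<in> idems S" using mult_idems_idem x y .
    have "x \<otimes> y = (x \<otimes> y) \<otimes> x" using x y idems_commute[OF x y]
      by (simp add: m_assoc idemsD idems_left_commute[OF x y])
    moreover have "x \<otimes> y = (x \<otimes> y) \<otimes> y" using x y by (simp add: m_assoc idemsD)
    ultimately have 1: "x \<otimes> y = (x \<otimes> y) \<otimes> ?m" using B.meet_le[of "x \<otimes> y" x y] x y xy by simp
    have "?m = ?m \<otimes> x" "?m = ?m \<otimes> y" using B.meet_left[of x y] B.meet_right[of x y] x y by auto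
    then have "?m = ?m \<otimes> (x \<otimes> y)" using x y m by (simp add: m_assoc[symmetric] idemsD(1))
    then show ?thesis using 1 idems_commute[OF m xy] by simp
  qed
  have zi: "z \<in> idems S" by (rule zero_idem[OF z])
  have bot: "\<bottom>\<^bsub>idem_order S\<^esub> = z"
    using B.bottom_lower[of z] B.bottom_closed zi z by (auto simp: is_zero_def)
  have top: "\<top>\<^bsub>idem_order S\<^esub> = \<one>"
    using B.top_higher[of \<one>] B.top_closed by auto
  obtain e' where e': "e' \<in> idems S" "e \<otimes> e' = z" "e \<squnion>\<^bsub>idem_order S\<^esub> e' = \<one>"
    using B.complement_ex[of e] e by (auto simp: meet bot top)
  have "f = f \<otimes> e" if f: "f \<in> idems S" and 0: "f \<otimes> e' = z" for f
  proof -
    have "f = f \<otimes> \<one>" using f by auto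
    also have "\<dots> = (f \<otimes> e) \<squnion>\<^bsub>idem_order S\<^esub> (f \<otimes> e')"
      using B.meet_join_distrib[of f e e'] f e e' by (simp add: meet)
    also have "\<dots> = f \<otimes> e"
    proof -
      have fe: "f \<otimes> e \<in> idems S" using mult_idems_idem f e .
      let ?j = "(f \<otimes> e) \<squnion>\<^bsub>idem_order S\<^esub> z"
      have j: "?j \<in> idems S" using B.join_closed fe zi by simp
      have "z = z \<otimes> (f \<otimes> e)" using z fe by (auto simp: is_zero_def)
      moreover have "f \<otimes> e = (f \<otimes> e) \<otimes> (f \<otimes> e)" using fe by auto
      ultimately have "?j \<sqsubseteq>\<^bsub>idem_order S\<^esub> f \<otimes> e" using fe zi by (intro B.join_le) simp_all
      then have "?j = ?j \<otimes> (f \<otimes> e)" by simp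
      moreover have "f \<otimes> e = (f \<otimes> e) \<otimes> ?j" using B.join_left[of "f \<otimes> e" z] fe zi by simp
      ultimately show ?thesis using 0 idems_commute[OF fe j] by simp
    qed
    finally show ?thesis .
  qed
  then show thesis using that e' by blast
qed

text \<open>The domain of \<open>b\<close> lies below \<open>p\<close> and its range below \<open>q\<close>.\<close>

lemma orthogonal_domain_range:
  assumes p: "p \<in> idems S" and q: "q \<in> idems S" and z: "is_zero S (p \<otimes> q)"
    and b: "b \<in> carrier S" and bp: "b \<otimes> p = b" and qb: "q \<otimes> b = b"
  shows "is_zero S ((b\<^sup>\<star> \<otimes> b) \<otimes> (b \<otimes> b\<^sup>\<star>))"
proof -
  have [simp]: "p \<in> carrier S" "q \<in> carrier S" using p q by auto
  have "(b\<^sup>\<star> \<otimes> b) \<otimes> (b \<otimes> b\<^sup>\<star>) = b\<^sup>\<star> \<otimes> (b \<otimes> p) \<otimes> ((q \<otimes> b) \<otimes> b\<^sup>\<star>)" by (simp add: bp qb)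
  also have "\<dots> = (b\<^sup>\<star> \<otimes> b) \<otimes> (p \<otimes> q) \<otimes> (b \<otimes> b\<^sup>\<star>)" using b by (simp add: m_assoc)
  also have "\<dots> = p \<otimes> q" using z b by (simp add: is_zero_def)
  finally show ?thesis using z by simp
qed

text \<open>Write \<open>a\<close> as a two by two matrix with respect to \<open>e\<close> and its complement. Were both
  off-diagonal blocks zero, \<open>a\<close> would be block diagonal and commute with \<open>e\<close>; and a nonzero
  off-diagonal block carries part of one of the two idempotents into the other one.\<close>

lemma noncommuting_orthogonal:
  assumes a [simp]: "a \<in> carrier S" and e: "e \<in> idems S" and ne: "a \<otimes> e \<noteq> e \<otimes> a"
  obtains b where "b \<in> carrier S" "\<not> is_zero S b" "b \<preceq> a"
    "is_zero S ((b\<^sup>\<star> \<otimes> b) \<otimes> (b \<otimes> b\<^sup>\<star>))"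
proof -
  obtain z where z: "is_zero S z" using zero_ex by blast
  have [simp]: "z \<in> carrier S" "\<And>s. s \<in> carrier S \<Longrightarrow> z \<otimes> s = z" "\<And>s. s \<in> carrier S \<Longrightarrow> s \<otimes> z = z"
    using z by (auto simp: is_zero_def)
  obtain e' where e': "e' \<in> idems S" "e \<otimes> e' = z"
    and le: "\<And>f. f \<in> idems S \<Longrightarrow> f \<otimes> e' = z \<Longrightarrow> f = f \<otimes> e"
    using idem_complement[OF e z] by blast
  have [simp]: "e \<in> carrier S" "e' \<in> carrier S" "e \<otimes> e = e" "e' \<otimes> e' = e'" using e e' by auto
  have e'e: "e' \<otimes> e = z" using idems_commute[OF e e'(1)] e'(2) by simp
  let ?b = "e' \<otimes> a \<otimes> e" and ?c = "e \<otimes> a \<otimes> e'"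
  have ba: "?b \<preceq> a" using nle_trans[OF mult_idem_nle[OF e] idem_mult_nle[OF e'(1)]] by simp
  have ca: "?c \<preceq> a" using nle_trans[OF mult_idem_nle[OF e'(1)] idem_mult_nle[OF e]] by simp
  have "is_zero S (e \<otimes> e')" "is_zero S (e' \<otimes> e)" using z e'(2) e'e by simp_all
  moreover have "?b \<otimes> e = ?b" "?c \<otimes> e' = ?c" by (simp_all add: m_assoc)
  moreover have "e' \<otimes> ?b = ?b" "e \<otimes> ?c = ?c"
    by (simp_all add: m_assoc idem_absorb[OF e] idem_absorb[OF e'(1)])
  ultimately have orth: "is_zero S ((?b\<^sup>\<star> \<otimes> ?b) \<otimes> (?b \<otimes> ?b\<^sup>\<star>))"
    "is_zero S ((?c\<^sup>\<star> \<otimes> ?c) \<otimes> (?c \<otimes> ?c\<^sup>\<star>))"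
    using orthogonal_domain_range[OF e e'(1), of ?b] orthogonal_domain_range[OF e'(1) e, of ?c]
    by simp_all
  have "\<not> (is_zero S ?b \<and> is_zero S ?c)"
  proof
    assume "is_zero S ?b \<and> is_zero S ?c"
    then have bz: "?b = z" and cz: "?c = z" using zero_unique z by blast+
    \<comment> \<open>Both conjugates of \<open>e\<close> by \<open>a\<close> are disjoint from the complement of \<open>e\<close>, so both lie
        below \<open>e\<close>; the first gives \<open>e a = e a e\<close> and the second \<open>a e = e a e\<close>.\<close>
    let ?f = "a\<^sup>\<star> \<otimes> e \<otimes> a" and ?r = "a \<otimes> e \<otimes> a\<^sup>\<star>"
    have f: "?f \<in> idems S" using conj_idem[OF e a] .
    have r: "?r \<in> idems S" using conj_idem[OF e, of "a\<^sup>\<star>"] by simp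
    have "?f \<otimes> e' = a\<^sup>\<star> \<otimes> ?c" by (simp add: m_assoc)
    then have "?f = ?f \<otimes> e" using le[OF f] unfolding cz by simp
    then have "a \<otimes> ?f = a \<otimes> ?f \<otimes> e" by (simp add: m_assoc)
    then have ea: "e \<otimes> a = e \<otimes> a \<otimes> e" by (simp only: idem_mult_eq_mult_conj[OF e a, symmetric])
    have "e' \<otimes> ?r = ?b \<otimes> a\<^sup>\<star>" by (simp add: m_assoc)
    then have "?r \<otimes> e' = z" unfolding bz idems_commute[OF r e'(1)] by simp
    then have "?r = ?r \<otimes> e" by (rule le[OF r])
    then have r': "?r = e \<otimes> ?r" unfolding idems_commute[OF r e] .
    have "?r \<otimes> a = a \<otimes> (e \<otimes> (a\<^sup>\<star> \<otimes> a))" by (simp add: m_assoc)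
    also have "\<dots> = a \<otimes> e" unfolding idems_commute[OF e domain_idem[OF a]] by (simp add: m_assoc)
    finally have ra: "?r \<otimes> a = a \<otimes> e" .
    have "?r \<otimes> a = e \<otimes> ?r \<otimes> a" using r' by simp
    also have "\<dots> = e \<otimes> (?r \<otimes> a)" by (simp add: m_assoc)
    finally have "a \<otimes> e = e \<otimes> (a \<otimes> e)" unfolding ra .
    also have "\<dots> = e \<otimes> a" using ea by (simp add: m_assoc)
    finally show False using ne by simp
  qed
  then show thesis using that[of ?b] that[of ?c] ba ca orth by (cases "is_zero S ?b") simp_all
qed

text \<open>With \<open>e = a \<and> 1\<close>, an ultrafilter through \<open>a e'\<close> that contains an idempotent contains
  an idempotent \<open>g \<le> a e'\<close>. Then \<open>g \<le> a\<close> and \<open>g \<le> 1\<close>, so \<open>g \<le> e\<close>, which makes \<open>g\<close> zero. Hence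
  \<open>a e' = 0\<close>, that is, \<open>a = a e = e\<close>.\<close>

lemma idem_if_ultrafilters_contain_idem:
  assumes a [simp]: "a \<in> carrier S"
    and h: "\<And>A. ultrafilter S A \<Longrightarrow> a \<in> A \<Longrightarrow> \<exists>e\<in>A. e \<in> idems S"
  shows "a \<in> idems S"
proof -
  obtain z where z: "is_zero S z" using zero_ex by blast
  have [simp]: "z \<in> carrier S" "\<And>s. s \<in> carrier S \<Longrightarrow> z \<otimes> s = z" "\<And>s. s \<in> carrier S \<Longrightarrow> s \<otimes> z = z"
    using z by (auto simp: is_zero_def)
  obtain e where e: "is_meet S e a \<one>" using meet_ex[OF a one_closed] by blast
  then have ec [simp]: "e \<in> carrier S" and ea: "e \<preceq> a" and e1: "e \<preceq> \<one>"
    and ge: "\<And>c. c \<in> carrier S \<Longrightarrow> c \<preceq> a \<Longrightarrow> c \<preceq> \<one> \<Longrightarrow> c \<preceq> e"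
    by (simp_all add: is_meet_iff)
  have ei: "e \<in> idems S" using idem_down_closed[OF e1] by simp
  obtain e' where e': "e' \<in> idems S" "e \<otimes> e' = z"
    and le: "\<And>f. f \<in> idems S \<Longrightarrow> f \<otimes> e' = z \<Longrightarrow> f = f \<otimes> e"
    using idem_complement[OF ei z] by blast
  have [simp]: "e' \<in> carrier S" using e' by auto
  have "a \<otimes> e' = z"
  proof (rule ccontr)
    assume "a \<otimes> e' \<noteq> z"
    then have "\<not> is_zero S (a \<otimes> e')" using zero_unique[OF _ z] by blast
    then obtain A where U: "ultrafilter S A" and bA: "a \<otimes> e' \<in> A"
      using ultrafilter_exists[of "a \<otimes> e'"] by auto
    have A: "proper_filter S A" using U by (simp add: ultrafilter_def)
    have ba: "a \<otimes> e' \<preceq> a" using mult_idem_nle e' by simp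
    then have "a \<in> A" using filter_up[OF A bA] by simp
    then obtain h where "h \<in> A" "h \<in> idems S" using h[OF U] by blast
    then obtain g where g: "g \<in> A" "g \<in> idems S" "g \<preceq> a \<otimes> e'"
      by (rule filter_below_idem[OF A _ _ bA])
    have [simp]: "g \<in> carrier S" using g by auto
    have "g \<preceq> \<one>" using nle_idem_iff[OF g(2) one_idem] by simp
    then have "g \<preceq> e" using ge nle_trans[OF g(3) ba] by simp
    then have "g = g \<otimes> e" using nle_idem_iff[OF g(2) ei] by simp
    then have ge: "g = e \<otimes> g" using idems_commute[OF g(2) ei] by simp
    have "g = a \<otimes> e' \<otimes> g \<otimes> g" using g(3) by (simp add: nle_iff sinv_idem[OF g(2)])
    then have "g = a \<otimes> e' \<otimes> g" using g(2) by (simp add: m_assoc idemsD)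
    also have "\<dots> = a \<otimes> e' \<otimes> (e \<otimes> g)" using ge by simp
    also have "\<dots> = a \<otimes> (e' \<otimes> e) \<otimes> g" by (simp add: m_assoc)
    also have "\<dots> = z" unfolding idems_commute[OF e'(1) ei] e'(2) by simp
    finally show False using filter_not_zero[OF A z] g(1) by simp
  qed
  then have "(a\<^sup>\<star> \<otimes> a) \<otimes> e' = z" by (simp add: m_assoc)
  then have d: "a\<^sup>\<star> \<otimes> a = (a\<^sup>\<star> \<otimes> a) \<otimes> e" by (rule le[OF domain_idem[OF a]])
  have "a = a \<otimes> (a\<^sup>\<star> \<otimes> a)" by simp
  also have "\<dots> = a \<otimes> ((a\<^sup>\<star> \<otimes> a) \<otimes> e)" by (simp only: d[symmetric])
  also have "\<dots> = a \<otimes> e" by (simp add: m_assoc)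
  also have "\<dots> = a \<otimes> e \<otimes> e" using ei by (auto simp: m_assoc)
  also have "\<dots> = e" using ea by (simp add: nle_iff sinv_idem[OF ei])
  finally show ?thesis using ei by simp
qed

end

section \<open>Effective groupoids and fundamental monoids\<close>

context boolean_inverse_meet_monoid
begin

text \<open>Elements that fail to commute with an idempotent are detected by a single point: an
  ultrafilter through a nonzero part of \<open>a\<close> whose domain and range are disjoint.\<close>

lemma basic_subset_Iso_iff_commute:
  assumes a: "a \<in> carrier S"
  shows "ultrafilters_at S a \<subseteq> Iso (ultrafilter_groupoid S) \<longleftrightarrow>
    (\<forall>e\<in>idems S. a \<otimes> e = e \<otimes> a)"
proof
  assume com: "\<forall>e\<in>idems S. a \<otimes> e = e \<otimes> a"
  show "ultrafilters_at S a \<subseteq> Iso (ultrafilter_groupoid S)"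
  proof
    fix A assume "A \<in> ultrafilters_at S a"
    then have U: "ultrafilter S A" and aA: "a \<in> A" by (auto simp: ultrafilters_at_def)
    then have "filter_dom A = filter_cod A"
      using filter_dom_eq_cod_if_commute[of A a] com by (simp add: ultrafilter_def)
    then show "A \<in> Iso (ultrafilter_groupoid S)" using U by (simp add: Iso_ultrafilter_groupoid)
  qed
next
  assume sub: "ultrafilters_at S a \<subseteq> Iso (ultrafilter_groupoid S)"
  show "\<forall>e\<in>idems S. a \<otimes> e = e \<otimes> a"
  proof (rule ccontr)
    assume "\<not> ?thesis"
    then obtain e where "e \<in> idems S" "a \<otimes> e \<noteq> e \<otimes> a" by blast
    then obtain b where b: "b \<in> carrier S" "\<not> is_zero S b" "b \<preceq> a"
      "is_zero S ((b\<^sup>\<star> \<otimes> b) \<otimes> (b \<otimes> b\<^sup>\<star>))"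
      using noncommuting_orthogonal[OF a] by blast
    obtain A where A: "ultrafilter S A" "b \<in> A" by (rule ultrafilter_exists[OF b(1,2)])
    then have P: "proper_filter S A" by (simp add: ultrafilter_def)
    have "A \<in> ultrafilters_at S a"
      using filter_up[OF P A(2) b(3) a] A by (simp add: ultrafilters_at_def)
    then have "filter_dom A = filter_cod A" using sub by (auto simp: Iso_ultrafilter_groupoid)
    then show False using filter_dom_cod_not_orthogonal[OF P A(2) b(4)] by simp
  qed
qed

end

theorem theorem4p10:
  fixes S :: "('a, 'b) monoid_scheme"
  assumes "boolean_inverse_meet_monoid S"
  shows "effective (ultrafilter_groupoid S) \<longleftrightarrow> fundamental S"
proof -
  interpret boolean_inverse_meet_monoid S by (rule assms)
  let ?G = "ultrafilter_groupoid S"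
  show ?thesis
  proof
    assume eff: "effective ?G"
    show "fundamental S" unfolding fundamental_def
    proof (intro ballI impI)
      fix s assume s: "s \<in> carrier S" and com: "\<forall>e\<in>idems S. s \<otimes>\<^bsub>S\<^esub> e = e \<otimes>\<^bsub>S\<^esub> s"
      have Iso: "ultrafilters_at S s \<subseteq> Iso ?G"
        using basic_subset_Iso_iff_commute[OF s] com by simp
      show "s \<in> idems S"
      proof (rule idem_if_ultrafilters_contain_idem[OF s])
        fix A assume "ultrafilter S A" "s \<in> A"
        then have "A \<in> ultrafilters_at S s" by (simp add: ultrafilters_at_def)
        then have "A \<in> (gtop ?G) interior_of (Iso ?G)"
          unfolding interior_Iso_iff using s Iso by blast
        then have "A \<in> identities ?G" using eff by (simp add: effective_def)
        then show "\<exists>e\<in>A. e \<in> idems S" by (simp add: identities_iff_idem)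
      qed
    qed
  next
    assume fund: "fundamental S"
    have idem: "ultrafilters_at S a \<subseteq> Iso ?G \<longleftrightarrow> a \<in> idems S" if a: "a \<in> carrier S" for a
    proof
      assume "ultrafilters_at S a \<subseteq> Iso ?G"
      then show "a \<in> idems S"
        using basic_subset_Iso_iff_commute[OF a] fund a by (simp add: fundamental_def)
    next
      assume "a \<in> idems S"
      then show "ultrafilters_at S a \<subseteq> Iso ?G"
        using basic_subset_Iso_iff_commute[OF a] idems_commute[of a] by simp
    qed
    show "effective ?G" unfolding effective_def
    proof (rule Set.set_eqI)
      fix A
      have "A \<in> (gtop ?G) interior_of (Iso ?G) \<longleftrightarrow>
          (\<exists>a\<in>carrier S. A \<in> ultrafilters_at S a \<and> a \<in> idems S)"
        unfolding interior_Iso_iff using idem by (intro bex_cong) simp_all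
      also have "\<dots> \<longleftrightarrow> A \<in> identities ?G"
        by (auto simp: identities_iff_idem ultrafilters_at_def)
      finally show "A \<in> (gtop ?G) interior_of (Iso ?G) \<longleftrightarrow> A \<in> identities ?G" .
    qed
  qed
qed

end
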